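(* Let $U\subseteq\mathbb{R}^n$ be a domain and $f:U\to Cl_n$ a left Clifford holomorphic function. Let $D(y,R)$ be a closed ball centered at $y$ of radius $R>0$ contained in $U$. Then \[f(y)=\frac{1}{R\,\omega_n}\int_{D(y,R)}\frac{f(x)}{\|x-y\|^{n-1}}\,dx^n,\] where $\omega_n$ is the surface area of the unit sphere in $\mathbb{R}^n$ and $dx^n$ is Lebesgue measure.
   Context: $Cl_n$ is the real Clifford algebra generated by an orthonormal basis $e_1,\ldots,e_n$ of $\mathbb{R}^n$ with $e_ie_j+e_je_i=-2\delta_{ij}$. A $C^1$ function $f:U\to Cl_n$ is left Clifford holomorphic if $\sum_{j=1}^n e_j\frac{\partial f}{\partial x_j}=0$ on $U$. *)

theory Defs
  imports "HOL-Analysis.Analysis"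
begin

text \<open>The real Clifford algebra Cl_n over R^n = real^'n, with 'n a finite linearly
ordered index type (n = CARD('n)).  An element is represented by its coefficients
with respect to the basis e_A, A a subset of the index set, where
e_A = e_a1 ... e_ak for a1 < ... < ak.  So Cl_n is the euclidean space real^('n set).\<close>

type_synonym 'n clifford = "(real, 'n set) vec"
type_synonym 'n rvec = "(real, 'n) vec"

text \<open>Sign in e_A e_B = cl_sign A B e_(A symmetric-difference B), derived from
e_i e_j = - e_j e_i (i ~= j) and e_i e_i = -1.\<close>
definition cl_sign :: "'n::{finite,linorder} set \<Rightarrow> 'n set \<Rightarrow> real" where
  "cl_sign A B = (-1) ^ (card {(a, b). a \<in> A \<and> b \<in> B \<and> b < a} + card (A \<inter> B))"

definition cl_mult :: "'n::{finite,linorder} clifford \<Rightarrow> 'n clifford \<Rightarrow> 'n clifford"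
  (infixl "\<odot>" 70) where
  "a \<odot> b = (\<chi> C. \<Sum>A\<in>UNIV. \<Sum>B\<in>UNIV.
      if (A - B) \<union> (B - A) = C then cl_sign A B * (a $ A) * (b $ B) else 0)"

definition cl_gen :: "'n::{finite,linorder} \<Rightarrow> 'n clifford" where
  "cl_gen j = (\<chi> A. if A = {j} then 1 else 0)"

definition C1_on :: "('a::euclidean_space \<Rightarrow> 'b::real_normed_vector) \<Rightarrow> 'a set \<Rightarrow> bool" where
  "C1_on f U \<longleftrightarrow> (\<exists>f'. (\<forall>x\<in>U. (f has_derivative blinfun_apply (f' x)) (at x))
                      \<and> continuous_on U f')"

definition left_clifford_holomorphic ::
  "(('n::{finite,linorder}) rvec \<Rightarrow> 'n clifford) \<Rightarrow> 'n rvec set \<Rightarrow> bool" where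
  "left_clifford_holomorphic (f :: ('n::{finite,linorder}) rvec \<Rightarrow> 'n clifford) U \<longleftrightarrow> C1_on f U \<and>
     (\<forall>x\<in>U. (\<Sum>j\<in>(UNIV :: 'n set). cl_gen j \<odot> frechet_derivative f (at x) (axis j 1)) = 0)"

definition sphere_area :: "nat \<Rightarrow> real" where
  "sphere_area n = 2 * pi powr (real n / 2) / Gamma (real n / 2)"

end

theory Submission
  imports Defs
begin

text \<open>
  Let \<open>w\<close> be a radial weight on the ball of radius \<open>R\<close> and consider
  \<open>I s = \<integral> w x *\<^sub>R f (y + s *\<^sub>R x)\<close> for \<open>0 \<le> s \<le> 1\<close>. Multiplying the equation
  \<open>\<Sum>k. e_k \<partial>_k f = 0\<close> from the left by \<open>\<Sum>j. x_j e_j\<close> expresses the radial derivative of \<open>f\<close> as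
  \<open>1/2 \<Sum>j k. e_j e_k (x_j \<partial>_k f - x_k \<partial>_j f)\<close>, a combination of angular derivatives. These
  integrate to zero against \<open>w\<close> because Lebesgue measure is rotation invariant, so \<open>I\<close> is constant
  and \<open>I 1 = I 0\<close>. No second derivatives and no surface integrals are involved. The theorem is the
  case \<open>w x = 1 / norm x ^ (n - 1)\<close>, whose integral follows from the volumes of balls.
\<close>

section \<open>Rotation invariance of Lebesgue measure\<close>

lemma nn_integral_lborel_translate:
  fixes f :: "'a::euclidean_space \<Rightarrow> ennreal"
  assumes [measurable]: "f \<in> borel_measurable borel"
  shows "(\<integral>\<^sup>+x. f (c + x) \<partial>lborel) = (\<integral>\<^sup>+x. f x \<partial>lborel)"
proof -
  have "(\<integral>\<^sup>+x. f x \<partial>lborel) = (\<integral>\<^sup>+x. f x \<partial>distr lborel borel ((+) c))"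
    by (simp add: lborel_distr_plus)
  also have "\<dots> = (\<integral>\<^sup>+x. f (c + x) \<partial>lborel)"
    by (rule nn_integral_distr) auto
  finally show ?thesis by simp
qed

text \<open>The uniqueness argument for translation-invariant measures: evaluating
  \<open>\<integral>\<integral> 1_A(x) 1_B(x - T y) dx dy\<close> in both orders, with \<open>B\<close> the unit ball, gives \<open>\<mu>(A) \<mu>(B)\<close> and
  \<open>\<mu>(T\<^sup>-\<^sup>1 A) \<mu>(B)\<close>.\<close>

lemma lborel_distr_orthogonal_transformation:
  fixes T :: "'a::euclidean_space \<Rightarrow> 'a"
  assumes T: "orthogonal_transformation T"
  shows "distr lborel borel T = lborel"
proof (rule measure_eqI)
  fix A assume "A \<in> sets (distr lborel borel T)"
  then have [measurable]: "A \<in> sets borel" by simp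
  have lin: "linear T" using T by (simp add: orthogonal_transformation_linear)
  have [measurable]: "T \<in> borel_measurable borel"
    by (intro borel_measurable_continuous_onI linear_continuous_on linear_linear[THEN iffD2] lin)
  \<comment> \<open>The right inverse \<open>S\<close> moves translations through \<open>T\<close>:
    \<open>x - T y = T (S x - y)\<close> and \<open>T y + z = T (S z + y)\<close>. The first, since
    \<open>T\<close> preserves norms, turns the inner integral over \<open>y\<close> into the volume
    of a unit ball; the second reduces to translation invariance.\<close>
  obtain S where S: "orthogonal_transformation S" and TS: "\<And>x. T (S x) = x"
    using T orthogonal_transformation_inv orthogonal_transformation_surj surj_f_inv_f by metis
  let ?V = "emeasure lborel (cball (0::'a) 1)"
  let ?B = "cball (0::'a) 1"
  have [measurable]: "cball c r \<in> sets borel" for c :: 'a and r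
    by (simp add: borel_closed)
  \<comment> \<open>The volume of the unit ball is positive and finite, so it can be cancelled at
    the end.\<close>
  have V: "?V \<noteq> 0" "?V \<noteq> \<infinity>"
    using unit_ball_vol_pos[of "real DIM('a)"] by (simp_all add: emeasure_cball del: unit_ball_vol_pos)
  have 1: "(\<integral>\<^sup>+y. indicator A x * indicator ?B (x - T y) \<partial>lborel) = indicator A x * ?V" for x
  proof -
    have "norm (x - T y) = norm (S x - y)" for y
    proof -
      have "x - T y = T (S x - y)" by (simp add: TS linear_diff[OF lin])
      then show ?thesis using T by (simp add: orthogonal_transformation_norm)
    qed
    then have eq: "indicator ?B (x - T y) = (indicator (cball (S x) 1) y :: ennreal)" for y
      by (simp add: indicator_def dist_norm[of "S x"])
    show ?thesis
      unfolding eq by (subst nn_integral_cmult) (auto simp: emeasure_cball)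
  qed
  have 2: "(\<integral>\<^sup>+x. indicator A x * indicator ?B (x - T y) \<partial>lborel)
         = (\<integral>\<^sup>+z. indicator A (T y + z) * indicator ?B z \<partial>lborel)" for y
    by (subst nn_integral_lborel_translate[of _ "T y", symmetric]) auto
  have 3: "(\<integral>\<^sup>+y. indicator A (T y + z) * indicator ?B z \<partial>lborel)
         = emeasure (distr lborel borel T) A * indicator ?B z" for z
  proof -
    have "(\<integral>\<^sup>+y. indicator A (T y + z) * indicator ?B z \<partial>lborel)
        = (\<integral>\<^sup>+y. indicator A (T (S z + y)) \<partial>lborel) * indicator ?B z"
      by (subst nn_integral_multc[symmetric]) (auto simp: linear_add[OF lin] TS add.commute)
    also have "(\<integral>\<^sup>+y. indicator A (T (S z + y)) \<partial>lborel) = (\<integral>\<^sup>+y. indicator A (T y) \<partial>lborel)"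
      by (rule nn_integral_lborel_translate) measurable
    also have "\<dots> = (\<integral>\<^sup>+y. indicator A y \<partial>distr lborel borel T)"
      by (subst nn_integral_distr) auto
    finally show ?thesis by simp
  qed
  have "emeasure lborel A * ?V
      = (\<integral>\<^sup>+x. \<integral>\<^sup>+y. indicator A x * indicator ?B (x - T y) \<partial>lborel \<partial>lborel)"
    unfolding 1 by (subst nn_integral_multc) auto
  also have "\<dots> = (\<integral>\<^sup>+y. \<integral>\<^sup>+x. indicator A x * indicator ?B (x - T y) \<partial>lborel \<partial>lborel)"
    by (rule lborel_pair.Fubini'[symmetric]) measurable
  also have "\<dots> = (\<integral>\<^sup>+y. \<integral>\<^sup>+z. indicator A (T y + z) * indicator ?B z \<partial>lborel \<partial>lborel)"
    unfolding 2 ..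
  also have "\<dots> = (\<integral>\<^sup>+z. \<integral>\<^sup>+y. indicator A (T y + z) * indicator ?B z \<partial>lborel \<partial>lborel)"
    by (rule lborel_pair.Fubini'[symmetric]) measurable
  also have "\<dots> = emeasure (distr lborel borel T) A * ?V"
    unfolding 3 by (subst nn_integral_cmult) auto
  finally have "?V * emeasure (distr lborel borel T) A = ?V * emeasure lborel A"
    by (simp only: mult.commute)
  then show "emeasure (distr lborel borel T) A = emeasure lborel A"
    using V unfolding ennreal_mult_cancel_left by auto
qed simp

lemma integral_orthogonal_transformation:
  fixes T :: "'a::euclidean_space \<Rightarrow> 'a" and f :: "'a \<Rightarrow> 'b::{banach, second_countable_topology}"
  assumes T: "orthogonal_transformation T" and [measurable]: "f \<in> borel_measurable borel"
  shows "(\<integral>x. f (T x) \<partial>lborel) = (\<integral>x. f x \<partial>lborel)"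
proof -
  have [measurable]: "T \<in> borel_measurable borel"
    using T by (intro borel_measurable_continuous_onI linear_continuous_on linear_linear[THEN iffD2])
      (simp add: orthogonal_transformation_linear)
  have "(\<integral>x. f x \<partial>lborel) = (\<integral>x. f x \<partial>distr lborel borel T)"
    by (simp add: lborel_distr_orthogonal_transformation[OF T])
  also have "\<dots> = (\<integral>x. f (T x) \<partial>lborel)"
    by (rule integral_distr) auto
  finally show ?thesis by simp
qed

section \<open>Derivatives of weighted integrals\<close>

text \<open>Difference quotients can be tested along sequences, which is the form that dominated
  convergence needs.\<close>

lemma has_vector_derivative_iff_quotient:
  fixes f :: "real \<Rightarrow> 'b::real_normed_vector"
  shows "(f has_vector_derivative D) (at t within S) \<longleftrightarrow>
    ((\<lambda>s. (1 / (s - t)) *\<^sub>R (f s - f t)) \<longlongrightarrow> D) (at t within S)"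
proof -
  have "norm ((1 / norm (s - t)) *\<^sub>R (f s - (f t + (s - t) *\<^sub>R D)))
      = norm ((1 / (s - t)) *\<^sub>R (f s - f t) - D)" if "s \<noteq> t" for s
  proof -
    have "(1 / (s - t)) *\<^sub>R (f s - f t) - D = (1 / (s - t)) *\<^sub>R (f s - (f t + (s - t) *\<^sub>R D))"
      using that by (simp add: scaleR_diff_right scaleR_add_right)
    then show ?thesis by simp
  qed
  then have "((\<lambda>s. norm ((1 / norm (s - t)) *\<^sub>R (f s - (f t + (s - t) *\<^sub>R D)))) \<longlongrightarrow> 0) (at t within S)
      \<longleftrightarrow> ((\<lambda>s. norm ((1 / (s - t)) *\<^sub>R (f s - f t) - D)) \<longlongrightarrow> 0) (at t within S)"
    by (intro filterlim_cong) (auto simp: eventually_at_filter)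
  then show ?thesis
    unfolding has_vector_derivative_def has_derivative_within
    by (simp only: tendsto_norm_zero_iff LIM_zero_iff bounded_linear_scaleR_left simp_thms)
qed

text \<open>Differentiation under the integral sign: the Lipschitz bound relative to the base point
  \<open>t\<close> says that every difference quotient is dominated by \<open>w\<close>, so
  dominated convergence applies along each sequence tending to \<open>t\<close>.\<close>

lemma has_vector_derivative_integral_dominated:
  fixes F :: "real \<Rightarrow> 'a \<Rightarrow> 'b::{banach, second_countable_topology}"
  assumes t: "t \<in> S" and F: "\<And>s. s \<in> S \<Longrightarrow> integrable M (F s)"
    and [measurable]: "F' \<in> borel_measurable M" and w: "integrable M w"
    and lip: "\<And>s x. s \<in> S \<Longrightarrow> x \<in> space M \<Longrightarrow> norm (F s x - F t x) \<le> w x * \<bar>s - t\<bar>"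
    and der: "\<And>x. x \<in> space M \<Longrightarrow> ((\<lambda>s. F s x) has_vector_derivative F' x) (at t within S)"
  shows "((\<lambda>s. \<integral>x. F s x \<partial>M) has_vector_derivative (\<integral>x. F' x \<partial>M)) (at t within S)"
  unfolding has_vector_derivative_iff_quotient tendsto_at_iff_sequentially comp_def
proof (intro allI impI)
  let ?I = "\<lambda>s. \<integral>x. F s x \<partial>M"
  fix X :: "nat \<Rightarrow> real" assume X: "\<forall>i. X i \<in> S - {t}" "X \<longlonglongrightarrow> t"
  let ?q = "\<lambda>i x. (1 / (X i - t)) *\<^sub>R (F (X i) x - F t x)"
  have XS: "X i \<in> S" "X i \<noteq> t" for i using X by auto
  have "(\<lambda>i. \<integral>x. ?q i x \<partial>M) \<longlonglongrightarrow> (\<integral>x. F' x \<partial>M)"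
  proof (rule integral_dominated_convergence[OF _ _ w])
    show "?q i \<in> borel_measurable M" for i
      using F[OF XS(1)] F[OF t] by (intro borel_measurable_scaleR borel_measurable_diff) auto
    show "AE x in M. norm (?q i x) \<le> w x" for i
    proof (rule AE_I2)
      fix x assume "x \<in> space M"
      from lip[OF XS(1) this] show "norm (?q i x) \<le> w x"
        using XS(2)[of i] by (simp add: pos_divide_le_eq)
    qed
    show "AE x in M. (\<lambda>i. ?q i x) \<longlonglongrightarrow> F' x"
    proof (rule AE_I2)
      fix x assume "x \<in> space M"
      from der[OF this] have "((\<lambda>s. (1 / (s - t)) *\<^sub>R (F s x - F t x)) \<longlongrightarrow> F' x) (at t within S)"
        by (simp add: has_vector_derivative_iff_quotient)
      then show "(\<lambda>i. ?q i x) \<longlonglongrightarrow> F' x"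
        using X by (simp add: tendsto_at_iff_sequentially comp_def)
    qed
  qed simp
  moreover have "(\<integral>x. ?q i x \<partial>M) = (1 / (X i - t)) *\<^sub>R (?I (X i) - ?I t)" for i
    using F[OF XS(1)] F[OF t] by simp
  ultimately show "(\<lambda>i. (1 / (X i - t)) *\<^sub>R (?I (X i) - ?I t)) \<longlonglongrightarrow> (\<integral>x. F' x \<partial>M)"
    by (simp only:)
qed

text \<open>On the compact ball \<open>g\<close> is bounded by some \<open>B\<close>, so
  \<open>B * w\<close> dominates. Since \<open>g\<close> is only controlled on the ball,
  measurability comes from cutting \<open>g\<close> off there, which changes nothing because
  \<open>w\<close> vanishes outside.\<close>

lemma integrable_scaleR_continuous_on_cball:
  fixes g :: "'a::euclidean_space \<Rightarrow> 'b::euclidean_space"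
  assumes w: "integrable lborel w" and w0: "\<And>x. x \<notin> cball 0 R \<Longrightarrow> w x = 0"
    and g: "continuous_on (cball 0 R) g"
  shows "integrable lborel (\<lambda>x. w x *\<^sub>R g x)"
proof -
  have [measurable]: "w \<in> borel_measurable borel"
    using borel_measurable_integrable[OF w] by simp
  have eq: "w x *\<^sub>R g x = w x *\<^sub>R (indicator (cball 0 R) x *\<^sub>R g x)" for x
    using w0[of x] by (auto simp: indicator_def)
  have [measurable]: "(\<lambda>x. indicator (cball 0 R) x *\<^sub>R g x) \<in> borel_measurable borel"
    by (rule borel_measurable_continuous_on_indicator[OF _ g]) (simp add: borel_closed)
  have "bounded (g ` cball 0 R)"
    by (intro compact_imp_bounded compact_continuous_image g) simp
  then obtain B where B: "0 < B" "\<And>x. x \<in> cball 0 R \<Longrightarrow> norm (g x) \<le> B"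
    by (auto simp: bounded_pos)
  show ?thesis
  proof (rule Bochner_Integration.integrable_bound)
    show "integrable lborel (\<lambda>x. B * w x)" using w by simp
    show "(\<lambda>x. w x *\<^sub>R g x) \<in> borel_measurable lborel"
      unfolding eq by measurable
    show "AE x in lborel. norm (w x *\<^sub>R g x) \<le> norm (B * w x)"
    proof (rule AE_I2)
      fix x
      show "norm (w x *\<^sub>R g x) \<le> norm (B * w x)"
        using B(1) B(2)[of x] w0[of x]
        by (cases "x \<in> cball 0 R") (auto simp: abs_mult mult.commute[of B] intro!: mult_left_mono)
    qed
  qed
qed

text \<open>Compactness bounds the operator norm of \<open>f'\<close>, and convexity of the ball
  turns this bound into a Lipschitz constant.\<close>

lemma C1_cball_Lipschitz:
  fixes f :: "'a::euclidean_space \<Rightarrow> 'b::euclidean_space"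
  assumes f: "\<And>x. x \<in> cball y R \<Longrightarrow> (f has_derivative blinfun_apply (f' x)) (at x)"
    and f': "continuous_on (cball y R) f'"
  obtains B where "0 < B"
    "\<And>u v. u \<in> cball y R \<Longrightarrow> v \<in> cball y R \<Longrightarrow> norm (f u - f v) \<le> B * norm (u - v)"
proof -
  have "bounded (f' ` cball y R)"
    by (intro compact_imp_bounded compact_continuous_image f') simp
  then obtain B where B: "0 < B" "\<And>x. x \<in> cball y R \<Longrightarrow> norm (f' x) \<le> B"
    by (auto simp: bounded_pos)
  have "norm (f u - f v) \<le> B * norm (u - v)" if "u \<in> cball y R" "v \<in> cball y R" for u v
    by (rule differentiable_bound[OF convex_cball has_derivative_at_withinI[OF f] _ that])
      (use B in \<open>auto simp flip: norm_blinfun.rep_eq\<close>)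
  with B(1) that show ?thesis by blast
qed

text \<open>Common to two motions \<open>c\<close> of the ball: the dilations, with
  \<open>S = {0..1}\<close>, and the rotations followed by a fixed dilation, with
  \<open>S = UNIV\<close>. The Lipschitz constants \<open>B\<close> of \<open>f\<close> and
  \<open>L\<close> of the motion give the dominating function
  \<open>B * L * \<bar>w x\<bar>\<close>, and the chain rule gives the pointwise derivative.\<close>

lemma has_vector_derivative_weighted_integral:
  fixes f :: "'a::euclidean_space \<Rightarrow> 'b::euclidean_space" and c :: "real \<Rightarrow> 'a \<Rightarrow> 'a"
  assumes w: "integrable lborel w" and w0: "\<And>x. x \<notin> cball 0 R \<Longrightarrow> w x = 0"
    and f: "\<And>x. x \<in> cball y R \<Longrightarrow> (f has_derivative blinfun_apply (f' x)) (at x)"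
    and f': "continuous_on (cball y R) f'"
    and t: "t \<in> S"
    and c: "\<And>s. s \<in> S \<Longrightarrow> continuous_on UNIV (c s)"
    and cR: "\<And>s x. s \<in> S \<Longrightarrow> norm x \<le> R \<Longrightarrow> norm (c s x) \<le> R"
    and lip: "\<And>s x. s \<in> S \<Longrightarrow> norm x \<le> R \<Longrightarrow> norm (c s x - c t x) \<le> L * \<bar>s - t\<bar>"
    and der: "\<And>x. ((\<lambda>s. c s x) has_vector_derivative v x) (at t within S)"
    and v: "continuous_on UNIV v"
  shows "((\<lambda>s. \<integral>x. w x *\<^sub>R f (y + c s x) \<partial>lborel) has_vector_derivative
    (\<integral>x. w x *\<^sub>R blinfun_apply (f' (y + c t x)) (v x) \<partial>lborel)) (at t within S)"
proof -
  obtain B where B: "0 < B"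
    "\<And>u v. u \<in> cball y R \<Longrightarrow> v \<in> cball y R \<Longrightarrow> norm (f u - f v) \<le> B * norm (u - v)"
    using C1_cball_Lipschitz[OF f f'] by blast
  have mem: "y + c s x \<in> cball y R" if "s \<in> S" "norm x \<le> R" for s x
    using cR[OF that] by (simp add: dist_norm)
  have fc: "continuous_on (cball y R) f"
    using f by (meson continuous_at_imp_continuous_on has_derivative_continuous)
  have cont: "continuous_on (cball 0 R) (\<lambda>x. y + c s x)" if "s \<in> S" for s
    using continuous_on_subset[OF c[OF that]] by (intro continuous_intros) auto
  show ?thesis
  proof (rule has_vector_derivative_integral_dominated[OF t])
    show "integrable lborel (\<lambda>x. w x *\<^sub>R f (y + c s x))" if "s \<in> S" for s
      by (rule integrable_scaleR_continuous_on_cball[OF w w0])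
        (use that in \<open>auto intro!: continuous_on_compose2[OF fc cont] mem\<close>)
    have "integrable lborel (\<lambda>x. w x *\<^sub>R blinfun_apply (f' (y + c t x)) (v x))"
      by (rule integrable_scaleR_continuous_on_cball[OF w w0])
        (use t v in \<open>auto intro!: continuous_intros continuous_on_compose2[OF f' cont] mem
          intro: continuous_on_subset\<close>)
    then show "(\<lambda>x. w x *\<^sub>R blinfun_apply (f' (y + c t x)) (v x)) \<in> borel_measurable lborel"
      by (rule borel_measurable_integrable)
    show "integrable lborel (\<lambda>x. B * L * \<bar>w x\<bar>)" using w by simp
    show "norm (w x *\<^sub>R f (y + c s x) - w x *\<^sub>R f (y + c t x)) \<le> B * L * \<bar>w x\<bar> * \<bar>s - t\<bar>"
      if s: "s \<in> S" for s x
    proof (cases "norm x \<le> R")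
      case True
      have "norm (f (y + c s x) - f (y + c t x)) \<le> B * norm (c s x - c t x)"
        using B(2)[OF mem[OF s True] mem[OF t True]] by simp
      also have "\<dots> \<le> B * (L * \<bar>s - t\<bar>)"
        using B(1) lip[OF s True] by simp
      finally have "\<bar>w x\<bar> * norm (f (y + c s x) - f (y + c t x)) \<le> \<bar>w x\<bar> * (B * (L * \<bar>s - t\<bar>))"
        by (rule mult_left_mono) simp
      then show ?thesis by (simp add: mult_ac flip: scaleR_diff_right)
    qed (use w0 in simp)
    show "((\<lambda>s. w x *\<^sub>R f (y + c s x)) has_vector_derivative
        w x *\<^sub>R blinfun_apply (f' (y + c t x)) (v x)) (at t within S)" for x
    proof (cases "norm x \<le> R")
      case True
      have "((\<lambda>s. y + c s x) has_vector_derivative v x) (at t within S)"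
        using der[of x] by (auto intro!: derivative_eq_intros)
      from vector_derivative_diff_chain_within[OF this has_derivative_at_withinI[OF f[OF mem[OF t True]]]]
      have "((\<lambda>s. f (y + c s x)) has_vector_derivative blinfun_apply (f' (y + c t x)) (v x)) (at t within S)"
        by (simp add: o_def)
      then show ?thesis
        by (auto intro!: derivative_eq_intros)
    qed (use w0 in simp)
  qed
qed

section \<open>Plane rotations and angular derivatives\<close>

text \<open>For orthonormal \<open>u\<close> and \<open>v\<close> this is the rotation by the angle
  \<open>\<theta>\<close> in their plane, fixing the orthogonal complement. Written as the identity
  plus a correction, it shows its derivative at angle 0:
  \<open>(x \<bullet> u) *\<^sub>R v - (x \<bullet> v) *\<^sub>R u\<close>.\<close>

definition plane_rotation :: "'a::real_inner \<Rightarrow> 'a \<Rightarrow> real \<Rightarrow> 'a \<Rightarrow> 'a" where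
  "plane_rotation u v \<theta> x = x + (cos \<theta> - 1) *\<^sub>R ((x \<bullet> u) *\<^sub>R u + (x \<bullet> v) *\<^sub>R v)
     + sin \<theta> *\<^sub>R ((x \<bullet> u) *\<^sub>R v - (x \<bullet> v) *\<^sub>R u)"

text \<open>With \<open>C = cos \<theta> - 1\<close> and \<open>S = sin \<theta>\<close>, the
  correction changes the squared norm by a multiple of \<open>2 * C + C\<^sup>2 + S\<^sup>2\<close>,
  which is \<open>(1 + C)\<^sup>2 + S\<^sup>2 - 1 = 0\<close>.\<close>

lemma orthogonal_transformation_plane_rotation:
  fixes u v :: "'a::euclidean_space"
  assumes uv: "u \<bullet> u = 1" "v \<bullet> v = 1" "u \<bullet> v = 0"
  shows "orthogonal_transformation (plane_rotation u v \<theta>)"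
proof -
  have "linear (plane_rotation u v \<theta>)"
    unfolding plane_rotation_def by (rule linearI) (simp_all add: algebra_simps inner_add_left)
  moreover have "norm (plane_rotation u v \<theta> x) = norm x" for x
  proof -
    let ?a = "x \<bullet> u" and ?b = "x \<bullet> v"
    define C S where "C = cos \<theta> - 1" and "S = sin \<theta>"
    have vu: "v \<bullet> u = 0" using uv by (simp add: inner_commute)
    have "plane_rotation u v \<theta> x \<bullet> plane_rotation u v \<theta> x
      = x \<bullet> x + (?a\<^sup>2 + ?b\<^sup>2) * (2 * C + C\<^sup>2 + S\<^sup>2)"
      unfolding plane_rotation_def C_def[symmetric] S_def[symmetric]
      by (simp add: inner_add_left inner_add_right inner_diff_left inner_diff_right uv vu
          inner_commute[of u x] inner_commute[of v x]) (simp add: algebra_simps power2_eq_square)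
    also have "2 * C + C\<^sup>2 + S\<^sup>2 = 0"
      using sin_cos_squared_add[of \<theta>] unfolding C_def S_def by (simp add: power2_eq_square algebra_simps)
    finally show ?thesis by (simp add: norm_eq_sqrt_inner)
  qed
  ultimately show ?thesis by (simp add: orthogonal_transformation)
qed

text \<open>Supplies the Lipschitz bound in the angle, relative to angle 0. The constant 4 is crude:
  the cosine and the sine term each contribute at most
  \<open>2 * norm x * \<bar>\<theta>\<bar>\<close>.\<close>

lemma norm_plane_rotation_diff_le:
  fixes u v :: "'a::euclidean_space"
  assumes uv: "norm u = 1" "norm v = 1"
  shows "norm (plane_rotation u v \<theta> x - x) \<le> 4 * norm x * \<bar>\<theta>\<bar>"
proof -
  have a: "norm ((x \<bullet> u) *\<^sub>R z) \<le> norm x" "norm ((x \<bullet> v) *\<^sub>R z) \<le> norm x" if "norm z = 1" for z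
    using Cauchy_Schwarz_ineq2[of x u] Cauchy_Schwarz_ineq2[of x v] uv that by simp_all
  have P: "norm ((x \<bullet> u) *\<^sub>R u + (x \<bullet> v) *\<^sub>R v) \<le> 2 * norm x"
    using norm_triangle_mono[OF a(1)[OF uv(1)] a(2)[OF uv(2)]] by simp
  have Q: "norm ((x \<bullet> u) *\<^sub>R v - (x \<bullet> v) *\<^sub>R u) \<le> 2 * norm x"
    using norm_triangle_le_diff[of "(x \<bullet> u) *\<^sub>R v" "(x \<bullet> v) *\<^sub>R u"] a(1)[OF uv(2)] a(2)[OF uv(1)] by simp
  have s: "\<bar>sin \<theta>\<bar> \<le> \<bar>\<theta>\<bar>" by (rule abs_sin_x_le_abs_x)
  have c: "\<bar>cos \<theta> - 1\<bar> \<le> \<bar>\<theta>\<bar>"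
  proof -
    have "cos \<theta> - 1 = - 2 * (sin (\<theta> / 2))\<^sup>2" using cos_double_sin[of "\<theta> / 2"] by simp
    then have "\<bar>cos \<theta> - 1\<bar> = 2 * (\<bar>sin (\<theta> / 2)\<bar> * \<bar>sin (\<theta> / 2)\<bar>)"
      by (simp add: power2_eq_square)
    also have "\<dots> \<le> 2 * (\<bar>\<theta> / 2\<bar> * 1)"
      by (intro mult_left_mono mult_mono abs_sin_x_le_abs_x abs_sin_le_one) auto
    finally show ?thesis by simp
  qed
  have "norm (plane_rotation u v \<theta> x - x) \<le>
    \<bar>cos \<theta> - 1\<bar> * norm ((x \<bullet> u) *\<^sub>R u + (x \<bullet> v) *\<^sub>R v)
    + \<bar>sin \<theta>\<bar> * norm ((x \<bullet> u) *\<^sub>R v - (x \<bullet> v) *\<^sub>R u)"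
    unfolding plane_rotation_def
    by (simp only: add.assoc add_diff_cancel_left') (rule norm_triangle_le, simp)
  also have "\<dots> \<le> \<bar>\<theta>\<bar> * (2 * norm x) + \<bar>\<theta>\<bar> * (2 * norm x)"
    by (intro add_mono mult_mono s c P Q) auto
  finally show ?thesis by (simp add: mult_ac)
qed

text \<open>Differentiating the rotation-invariant integral of \<open>w x *\<^sub>R f (y + s *\<^sub>R x)\<close>
  along the rotations of the plane spanned by \<open>u\<close> and \<open>v\<close> shows that angular derivatives
  of \<open>f\<close> integrate to zero against a radial weight.\<close>

lemma integral_radial_weight_angular_derivative:
  fixes f :: "'a::euclidean_space \<Rightarrow> 'b::euclidean_space"
  assumes w: "integrable lborel w" and w0: "\<And>x. x \<notin> cball 0 R \<Longrightarrow> w x = 0"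
    and radial: "\<And>T x. orthogonal_transformation T \<Longrightarrow> w (T x) = w x"
    and f: "\<And>x. x \<in> cball y R \<Longrightarrow> (f has_derivative blinfun_apply (f' x)) (at x)"
    and f': "continuous_on (cball y R) f'"
    and s: "0 < s" "s \<le> 1" and uv: "u \<bullet> u = 1" "v \<bullet> v = 1" "u \<bullet> v = 0"
  shows "(\<integral>x. w x *\<^sub>R blinfun_apply (f' (y + s *\<^sub>R x)) ((x \<bullet> u) *\<^sub>R v - (x \<bullet> v) *\<^sub>R u) \<partial>lborel) = 0"
proof -
  let ?T = "plane_rotation u v" and ?z = "\<lambda>x. (x \<bullet> u) *\<^sub>R v - (x \<bullet> v) *\<^sub>R u"
  have T: "orthogonal_transformation (?T \<theta>)" for \<theta>
    by (rule orthogonal_transformation_plane_rotation[OF uv])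
  have T0: "?T 0 x = x" for x by (simp add: plane_rotation_def)
  have n: "norm u = 1" "norm v = 1" using uv by (simp_all add: norm_eq_sqrt_inner)
  have sR: "norm (s *\<^sub>R x) \<le> R" if "norm x \<le> R" for x :: 'a
    using s that mult_left_le_one_le[of "norm x" s] by simp
  have "((\<lambda>\<theta>. \<integral>x. w x *\<^sub>R f (y + s *\<^sub>R ?T \<theta> x) \<partial>lborel) has_vector_derivative
    (\<integral>x. w x *\<^sub>R blinfun_apply (f' (y + s *\<^sub>R ?T 0 x)) (s *\<^sub>R ?z x) \<partial>lborel)) (at 0 within UNIV)"
  proof (rule has_vector_derivative_weighted_integral[OF w w0 f f'])
    show "continuous_on UNIV (\<lambda>x. s *\<^sub>R ?T \<theta> x)" for \<theta>
      unfolding plane_rotation_def by (intro continuous_intros)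
    show "norm (s *\<^sub>R ?T \<theta> x) \<le> R" if "norm x \<le> R" for \<theta> x
      using sR[of "?T \<theta> x"] that by (simp add: orthogonal_transformation_norm[OF T])
    show "norm (s *\<^sub>R ?T \<theta> x - s *\<^sub>R ?T 0 x) \<le> (s * (4 * R)) * \<bar>\<theta> - 0\<bar>" if "norm x \<le> R" for \<theta> x
    proof -
      have "norm (s *\<^sub>R ?T \<theta> x - s *\<^sub>R ?T 0 x) = s * norm (?T \<theta> x - x)"
        using s by (simp add: T0 flip: scaleR_diff_right)
      also have "\<dots> \<le> s * (4 * R * \<bar>\<theta>\<bar>)"
        using s that by (intro mult_left_mono order_trans[OF norm_plane_rotation_diff_le[OF n]] mult_right_mono) auto
      finally show ?thesis by simp
    qed
    show "((\<lambda>\<theta>. s *\<^sub>R ?T \<theta> x) has_vector_derivative s *\<^sub>R ?z x) (at 0 within UNIV)" for x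
      unfolding plane_rotation_def
      by (rule has_vector_derivative_eq_rhs) (auto intro!: derivative_eq_intros)
    show "continuous_on UNIV (\<lambda>x. s *\<^sub>R ?z x)" by (intro continuous_intros)
  qed auto
  moreover have "(\<integral>x. w x *\<^sub>R blinfun_apply (f' (y + s *\<^sub>R ?T 0 x)) (s *\<^sub>R ?z x) \<partial>lborel)
    = s *\<^sub>R (\<integral>x. w x *\<^sub>R blinfun_apply (f' (y + s *\<^sub>R x)) (?z x) \<partial>lborel)"
    unfolding integral_scaleR_right[symmetric] T0 blinfun.scaleR_right by (simp only: scaleR_left_commute)
  ultimately have "((\<lambda>\<theta>. \<integral>x. w x *\<^sub>R f (y + s *\<^sub>R ?T \<theta> x) \<partial>lborel) has_vector_derivative
    s *\<^sub>R (\<integral>x. w x *\<^sub>R blinfun_apply (f' (y + s *\<^sub>R x)) (?z x) \<partial>lborel)) (at 0)"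
    by simp
  \<comment> \<open>As \<open>w\<close> is radial, the integrand is a fixed function composed with a
    rotation, so the integral does not depend on the angle and its derivative must vanish. The
    factor \<open>s\<close> is then cancelled, which is why \<open>s\<close> is positive.\<close>
  moreover have "(\<integral>x. w x *\<^sub>R f (y + s *\<^sub>R ?T \<theta> x) \<partial>lborel) = (\<integral>x. w x *\<^sub>R f (y + s *\<^sub>R x) \<partial>lborel)" for \<theta>
  proof -
    have fc: "continuous_on (cball y R) f"
      using f by (meson continuous_at_imp_continuous_on has_derivative_continuous)
    have "integrable lborel (\<lambda>x. w x *\<^sub>R f (y + s *\<^sub>R x))"
      by (rule integrable_scaleR_continuous_on_cball[OF w w0])
        (auto intro!: continuous_on_compose2[OF fc] continuous_intros simp: dist_norm sR[simplified])
    from borel_measurable_integrable[OF this]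
    show ?thesis
      using integral_orthogonal_transformation[OF T, of "\<lambda>x. w x *\<^sub>R f (y + s *\<^sub>R x)" \<theta>]
      by (simp add: radial[OF T])
  qed
  ultimately have "((\<lambda>\<theta>. \<integral>x. w x *\<^sub>R f (y + s *\<^sub>R x) \<partial>lborel) has_vector_derivative
    s *\<^sub>R (\<integral>x. w x *\<^sub>R blinfun_apply (f' (y + s *\<^sub>R x)) (?z x) \<partial>lborel)) (at 0)"
    by simp
  from vector_derivative_unique_at[OF this has_vector_derivative_const]
  have "s *\<^sub>R (\<integral>x. w x *\<^sub>R blinfun_apply (f' (y + s *\<^sub>R x)) (?z x) \<partial>lborel) = 0" .
  then show ?thesis using s by simp
qed

section \<open>Clifford holomorphic functions\<close>

text \<open>Only the basis element indexed by \<open>B = sym_diff C {j}\<close> contributes to the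
  coefficient at \<open>C\<close>. Its sign counts the indices of \<open>B\<close> below
  \<open>j\<close> that \<open>e_j\<close> has to pass, plus one if \<open>j\<close> lies in
  \<open>B\<close> because \<open>e_j\<close> squares to -1; together these are the indices of
  \<open>B\<close> up to \<open>j\<close>.\<close>

lemma cl_gen_mult_nth:
  "(cl_gen j \<odot> b) $ C = (-1) ^ card {i \<in> sym_diff C {j}. i \<le> j} * b $ sym_diff C {j}"
proof -
  have card: "card {(a, b). a \<in> {j} \<and> b \<in> B \<and> b < a} + card ({j} \<inter> B) = card {i \<in> B. i \<le> j}" for B
  proof -
    have "{(a, b). a \<in> {j} \<and> b \<in> B \<and> b < a} = Pair j ` {i \<in> B. i < j}" by auto
    then have "card {(a, b). a \<in> {j} \<and> b \<in> B \<and> b < a} = card {i \<in> B. i < j}"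
      by (simp add: card_image inj_on_def)
    moreover have "{i \<in> B. i \<le> j} = {i \<in> B. i < j} \<union> ({j} \<inter> B)" by auto
    moreover have "card ({i \<in> B. i < j} \<union> ({j} \<inter> B)) = card {i \<in> B. i < j} + card ({j} \<inter> B)"
      by (rule card_Un_disjoint) auto
    ultimately show ?thesis by simp
  qed
  have iff: "sym_diff {j} B = C \<longleftrightarrow> B = sym_diff C {j}" for B by auto
  have "(cl_gen j \<odot> b) $ C = (\<Sum>A\<in>UNIV. if A = {j} then
      (\<Sum>B\<in>UNIV. if sym_diff {j} B = C then cl_sign {j} B * b $ B else 0) else 0)"
    unfolding cl_mult_def cl_gen_def vec_lambda_beta
    by (rule sum.cong[OF refl]) (simp cong: if_cong)
  also have "\<dots> = cl_sign {j} (sym_diff C {j}) * b $ sym_diff C {j}"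
    unfolding iff by simp
  finally show ?thesis by (simp only: cl_sign_def card)
qed

lemma cl_gen_mult_linear: "linear (\<lambda>b. cl_gen j \<odot> b)"
  by (rule linearI) (simp_all add: vec_eq_iff cl_gen_mult_nth algebra_simps)

text \<open>Toggling the membership of an index \<open>k\<close> up to \<open>j\<close> changes the
  count by exactly one, hence its parity.\<close>

lemma cl_gen_sign_flip:
  fixes j k :: "'n::{finite,linorder}"
  assumes "k \<le> j"
  shows "(-1 :: real) ^ card {i \<in> sym_diff C {k}. i \<le> j} = - ((-1) ^ card {i \<in> C. i \<le> j})"
proof (cases "k \<in> C")
  case True
  then have "{i \<in> C. i \<le> j} = insert k {i \<in> sym_diff C {k}. i \<le> j}" using assms by auto
  then have "card {i \<in> C. i \<le> j} = Suc (card {i \<in> sym_diff C {k}. i \<le> j})"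
    using True by simp
  then show ?thesis by simp
next
  case False
  then have "{i \<in> sym_diff C {k}. i \<le> j} = insert k {i \<in> C. i \<le> j}" using assms by auto
  then have "card {i \<in> sym_diff C {k}. i \<le> j} = Suc (card {i \<in> C. i \<le> j})"
    using False by simp
  then show ?thesis by simp
qed

lemma cl_gen_square: "cl_gen j \<odot> (cl_gen j \<odot> b) = - b"
proof -
  have "sym_diff (sym_diff C {j}) {j} = C" for C :: "'a set" by auto
  then show ?thesis
    unfolding vec_eq_iff cl_gen_mult_nth by (simp only: cl_gen_sign_flip[OF order_refl]) simp
qed

text \<open>Toggling \<open>j\<close> changes the number of indices up to \<open>k\<close>, while
  toggling \<open>k\<close> leaves the number of indices up to \<open>j\<close> unchanged. Hence the
  two orders differ by exactly one sign.\<close>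

lemma cl_gen_anticommute_less:
  assumes "j < k"
  shows "cl_gen j \<odot> (cl_gen k \<odot> b) = - (cl_gen k \<odot> (cl_gen j \<odot> b))"
proof -
  have comm: "sym_diff (sym_diff C {j}) {k} = sym_diff (sym_diff C {k}) {j}" for C by auto
  have eq: "{i \<in> sym_diff C {k}. i \<le> j} = {i \<in> C. i \<le> j}" for C using assms by auto
  show ?thesis
    unfolding vec_eq_iff cl_gen_mult_nth uminus_vec_def vec_lambda_beta
    by (simp only: comm eq cl_gen_sign_flip[OF order_refl] cl_gen_sign_flip[OF less_imp_le[OF assms]])
      (simp only: mult_minus_left mult_minus_right minus_minus mult.left_commute, simp)
qed

lemma cl_gen_anticommute:
  "cl_gen j \<odot> (cl_gen k \<odot> b) + cl_gen k \<odot> (cl_gen j \<odot> b) = (if j = k then - 2 *\<^sub>R b else 0)"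
proof (cases "j = k")
  case True
  then show ?thesis using scaleR_2[of b] by (simp add: cl_gen_square)
next
  case False
  then show ?thesis
    using cl_gen_anticommute_less[of j k b] cl_gen_anticommute_less[of k j b]
    by (cases j k rule: linorder_cases) auto
qed

text \<open>Here \<open>d j\<close> stands for the j-th partial derivative at a point. The
  differences \<open>x $ j *\<^sub>R d k - x $ k *\<^sub>R d j\<close> are derivatives along
  rotations; the factor 2 comes from the anticommutator.\<close>

lemma radial_derivative_eq_rotations:
  fixes d :: "'n::{finite,linorder} \<Rightarrow> 'n clifford" and x :: "'n rvec"
  assumes "(\<Sum>j\<in>UNIV. cl_gen j \<odot> d j) = 0"
  shows "2 *\<^sub>R (\<Sum>j\<in>UNIV. x $ j *\<^sub>R d j) =
    (\<Sum>j\<in>UNIV. \<Sum>k\<in>UNIV. cl_gen j \<odot> (cl_gen k \<odot> (x $ j *\<^sub>R d k - x $ k *\<^sub>R d j)))"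
proof -
  note lin = linear_sum[OF cl_gen_mult_linear] linear_scale[OF cl_gen_mult_linear]
    linear_diff[OF cl_gen_mult_linear] linear_0[OF cl_gen_mult_linear]
  have z: "(\<Sum>j\<in>UNIV. \<Sum>k\<in>UNIV. x $ j *\<^sub>R (cl_gen j \<odot> (cl_gen k \<odot> d k))) = 0"
    unfolding scaleR_sum_right[symmetric] lin(1)[symmetric] assms by (simp add: lin)
  have "(\<Sum>j\<in>UNIV. \<Sum>k\<in>UNIV. cl_gen j \<odot> (cl_gen k \<odot> (x $ j *\<^sub>R d k - x $ k *\<^sub>R d j)))
     = - (\<Sum>j\<in>UNIV. \<Sum>k\<in>UNIV. x $ k *\<^sub>R (cl_gen j \<odot> (cl_gen k \<odot> d j)))"
    by (simp add: lin sum_subtractf z)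
  also have "\<dots> = - (\<Sum>j\<in>UNIV. \<Sum>k\<in>UNIV. x $ j *\<^sub>R (cl_gen k \<odot> (cl_gen j \<odot> d k)))"
    by (subst sum.swap) simp
  \<comment> \<open>Adding the vanishing sum \<open>z\<close> completes the anticommutator, of which
    only the diagonal terms \<open>j = k\<close> survive.\<close>
  also have "\<dots> = - (\<Sum>j\<in>UNIV. \<Sum>k\<in>UNIV. x $ j *\<^sub>R (cl_gen j \<odot> (cl_gen k \<odot> d k) + cl_gen k \<odot> (cl_gen j \<odot> d k)))"
    by (simp add: scaleR_add_right sum.distrib z)
  also have "\<dots> = 2 *\<^sub>R (\<Sum>j\<in>UNIV. x $ j *\<^sub>R d j)"
    by (simp add: cl_gen_anticommute if_distrib sum_negf scaleR_sum_right mult.commute cong: if_cong)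
  finally show ?thesis by simp
qed

section \<open>The mean value property for arbitrary integrable radial weights\<close>

lemma clifford_holomorphic_radial_weight_mean_value:
  fixes f :: "('n::{finite,linorder}) rvec \<Rightarrow> 'n clifford"
  assumes w: "integrable lborel w" and w0: "\<And>x. x \<notin> cball 0 R \<Longrightarrow> w x = 0"
    and radial: "\<And>T x. orthogonal_transformation T \<Longrightarrow> w (T x) = w x"
    and f: "\<And>x. x \<in> cball y R \<Longrightarrow> (f has_derivative blinfun_apply (f' x)) (at x)"
    and f': "continuous_on (cball y R) f'"
    and hol: "\<And>x. x \<in> cball y R \<Longrightarrow> (\<Sum>j\<in>UNIV. cl_gen j \<odot> blinfun_apply (f' x) (axis j 1)) = 0"
  shows "(\<integral>x. w x *\<^sub>R f (y + x) \<partial>lborel) = (\<integral>x. w x \<partial>lborel) *\<^sub>R f y"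
proof -
  let ?I = "\<lambda>s. \<integral>x. w x *\<^sub>R f (y + s *\<^sub>R x) \<partial>lborel"
  have sR: "norm (s *\<^sub>R x) \<le> R" if "norm x \<le> R" "s \<in> {0..1}" for s and x :: "'n rvec"
    using that mult_left_le_one_le[of "norm x" s] by simp
  have der: "(?I has_vector_derivative (\<integral>x. w x *\<^sub>R blinfun_apply (f' (y + s *\<^sub>R x)) x \<partial>lborel)) (at s within {0..1})"
    if s: "s \<in> {0..1}" for s
  proof (rule has_vector_derivative_weighted_integral[OF w w0 f f' s])
    show "norm (r *\<^sub>R x - s *\<^sub>R x) \<le> R * \<bar>r - s\<bar>" if "norm x \<le> R" for r and x :: "'n rvec"
      using that by (simp add: mult.commute[of R] mult_left_mono flip: scaleR_diff_left)
    show "((\<lambda>s. s *\<^sub>R x) has_vector_derivative x) (at s within {0..1})" for x :: "'n rvec"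
      by (rule has_vector_derivative_eq_rhs) (auto intro!: derivative_eq_intros)
    show "norm (r *\<^sub>R x) \<le> R" if "r \<in> {0..1}" "norm x \<le> R" for r and x :: "'n rvec"
      using sR that by blast
  qed (auto intro!: continuous_intros)
  have zero: "(\<integral>x. w x *\<^sub>R blinfun_apply (f' (y + s *\<^sub>R x)) x \<partial>lborel) = 0" if s: "0 < s" "s \<le> 1" for s
  proof -
    \<comment> \<open>The weighted angular derivative in the plane of the axes \<open>j\<close> and
      \<open>k\<close>; it is zero when \<open>j = k\<close>.\<close>
    define h where "h j k x = w x *\<^sub>R blinfun_apply (f' (y + s *\<^sub>R x)) (x $ j *\<^sub>R axis k 1 - x $ k *\<^sub>R axis j 1)"
      for j k x
    have mem: "y + s *\<^sub>R x \<in> cball y R" if "norm x \<le> R" for x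
      using sR[OF that, of s] s by (simp add: dist_norm)
    have h: "integrable lborel (h j k)" for j k
      unfolding h_def
      by (rule integrable_scaleR_continuous_on_cball[OF w w0])
        (auto intro!: continuous_intros continuous_on_compose2[OF f'] mem simp del: mem_cball)
    have h0: "(\<integral>x. h j k x \<partial>lborel) = 0" for j k
    proof (cases "j = k")
      case False
      have "h j k = (\<lambda>x. w x *\<^sub>R blinfun_apply (f' (y + s *\<^sub>R x))
          ((x \<bullet> axis j 1) *\<^sub>R axis k 1 - (x \<bullet> axis k 1) *\<^sub>R axis j 1))"
        by (simp add: h_def[abs_def] inner_axis)
      moreover have "(\<integral>x. w x *\<^sub>R blinfun_apply (f' (y + s *\<^sub>R x))
          ((x \<bullet> axis j 1) *\<^sub>R axis k 1 - (x \<bullet> axis k 1) *\<^sub>R axis j 1) \<partial>lborel) = 0"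
        by (rule integral_radial_weight_angular_derivative[where f' = f', OF w w0 _ f f' s])
          (use radial False in \<open>auto simp: inner_axis_axis\<close>)
      ultimately show ?thesis by simp
    qed (simp add: h_def blinfun.zero_right)
    have bl: "bounded_linear (\<lambda>b. cl_gen j \<odot> (cl_gen k \<odot> b))" for j k :: 'n
      using linear_compose[OF cl_gen_mult_linear[of k] cl_gen_mult_linear[of j]]
      by (simp add: linear_conv_bounded_linear o_def)
    \<comment> \<open>Inside the ball this is the algebraic identity for the radial derivative;
      outside, where nothing is known about \<open>f'\<close>, both sides vanish with
      \<open>w\<close>.\<close>
    have eq: "2 *\<^sub>R (w x *\<^sub>R blinfun_apply (f' (y + s *\<^sub>R x)) x)
        = (\<Sum>j\<in>UNIV. \<Sum>k\<in>UNIV. cl_gen j \<odot> (cl_gen k \<odot> h j k x))" for x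
    proof (cases "norm x \<le> R")
      case True
      let ?d = "\<lambda>j. blinfun_apply (f' (y + s *\<^sub>R x)) (axis j 1)"
      have "blinfun_apply (f' (y + s *\<^sub>R x)) x = blinfun_apply (f' (y + s *\<^sub>R x)) (\<Sum>j\<in>UNIV. x $ j *\<^sub>R axis j 1)"
        using basis_expansion[of x] by (simp add: scalar_mult_eq_scaleR)
      also have "\<dots> = (\<Sum>j\<in>UNIV. x $ j *\<^sub>R ?d j)"
        by (simp add: blinfun.sum_right blinfun.scaleR_right)
      finally have "2 *\<^sub>R blinfun_apply (f' (y + s *\<^sub>R x)) x =
          (\<Sum>j\<in>UNIV. \<Sum>k\<in>UNIV. cl_gen j \<odot> (cl_gen k \<odot> (x $ j *\<^sub>R ?d k - x $ k *\<^sub>R ?d j)))"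
        using radial_derivative_eq_rotations[OF hol[OF mem[OF True]]] by simp
      then have "w x *\<^sub>R 2 *\<^sub>R blinfun_apply (f' (y + s *\<^sub>R x)) x =
          w x *\<^sub>R (\<Sum>j\<in>UNIV. \<Sum>k\<in>UNIV. cl_gen j \<odot> (cl_gen k \<odot> (x $ j *\<^sub>R ?d k - x $ k *\<^sub>R ?d j)))"
        by simp
      then show ?thesis
        unfolding h_def linear_scale[OF cl_gen_mult_linear] scaleR_sum_right blinfun.diff_right blinfun.scaleR_right
        by (simp only: scaleR_left_commute)
    next
      case False
      then show ?thesis using w0[of x] by (simp add: h_def linear_0[OF cl_gen_mult_linear])
    qed
    have "2 *\<^sub>R (\<integral>x. w x *\<^sub>R blinfun_apply (f' (y + s *\<^sub>R x)) x \<partial>lborel)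
        = (\<integral>x. (\<Sum>j\<in>UNIV. \<Sum>k\<in>UNIV. cl_gen j \<odot> (cl_gen k \<odot> h j k x)) \<partial>lborel)"
      by (simp only: eq flip: integral_scaleR_right)
    also have "\<dots> = (\<Sum>j\<in>UNIV. \<Sum>k\<in>UNIV. \<integral>x. cl_gen j \<odot> (cl_gen k \<odot> h j k x) \<partial>lborel)"
      by (simp add: Bochner_Integration.integral_sum Bochner_Integration.integrable_sum integrable_bounded_linear[OF bl h])
    also have "\<dots> = 0"
      by (simp add: integral_bounded_linear[OF bl h] h0 linear_0[OF cl_gen_mult_linear])
    finally show ?thesis by simp
  qed
  \<comment> \<open>The vanishing of the derivative is known only for positive \<open>s\<close>;
    continuity of \<open>?I\<close> bridges the exceptional point 0.\<close>
  have "?I 1 = ?I 0"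
  proof (rule has_derivative_zero_unique_strong_interval[of "{0}" 0 1 ?I])
    show "continuous_on {0..1} ?I"
      using der by (meson continuous_on_eq_continuous_within has_vector_derivative_continuous)
    show "(?I has_derivative (\<lambda>h. 0)) (at s within {0..1})" if "s \<in> {0..1} - {0}" for s
      using der[of s] zero[of s] that by (simp add: has_vector_derivative_def)
  qed auto
  then show ?thesis using w by simp
qed

section \<open>The integral of the weight\<close>

text \<open>Integration in polar coordinates for radial functions. Both measures are compared on the
  rays \<open>{x<..}\<close>: on the left stands the volume of a shell, on the right the integral of
  the derivative of \<open>?V * r ^ ?n\<close>.\<close>

lemma distr_norm_cball:
  fixes R :: real
  assumes "0 < R"
  shows "distr (density lborel (indicator (cball (0::'a::euclidean_space) R))) borel norm =
    density lborel (\<lambda>r. ennreal (real DIM('a) * unit_ball_vol DIM('a) * r ^ (DIM('a) - 1)) * indicator {0..R} r)"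
    (is "?M = ?N")
proof (rule measure_eqI_lessThan)
  let ?n = "DIM('a)" and ?V = "unit_ball_vol (real DIM('a))"
  fix x :: real
  have [measurable]: "cball (0::'a) r \<in> sets borel" for r
    by (simp add: borel_closed)
  \<comment> \<open>The inner radius of the shell: \<open>x\<close> clamped to the interval from 0
    to \<open>R\<close>.\<close>
  let ?m = "min (max 0 x) R"
  have m: "0 \<le> ?m" "?m \<le> R" using assms by auto
  have V: "0 \<le> ?V" by simp
  have "emeasure ?M {x<..} = emeasure (density lborel (indicator (cball (0::'a) R))) (norm -` {x<..})"
    by (subst emeasure_distr) auto
  also have "\<dots> = (\<integral>\<^sup>+z. indicator (cball 0 R) z * indicator (norm -` {x<..}) (z::'a) \<partial>lborel)"
  proof (rule emeasure_density)
    have "norm -` {x<..} \<inter> space borel \<in> sets (borel :: 'a measure)"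
      by (rule measurable_sets[of _ _ borel]) auto
    then show "norm -` {x<..} \<in> sets (lborel :: 'a measure)" by simp
  qed simp
  \<comment> \<open>For negative \<open>x\<close> the centre belongs to the set, so nothing may be
    removed, although \<open>?m = 0\<close> would remove the centre.\<close>
  also have "\<dots> = (\<integral>\<^sup>+z. indicator (cball 0 R - (if x < 0 then {} else cball 0 ?m)) (z::'a) \<partial>lborel)"
    by (intro nn_integral_cong) (auto simp: indicator_def min_def max_def split: if_splits dest: order_trans[OF norm_ge_zero])
  also have "\<dots> = emeasure lborel (cball (0::'a) R - (if x < 0 then {} else cball 0 ?m))"
    by simp
  also have "\<dots> = ennreal (?V * R ^ ?n - ?V * ?m ^ ?n)"
  proof (cases "x < 0")
    case True
    then show ?thesis using assms by (simp add: emeasure_cball)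
  next
    case False
    have "emeasure lborel (cball (0::'a) R - cball 0 ?m)
        = emeasure lborel (cball (0::'a) R) - emeasure lborel (cball (0::'a) ?m)"
      by (rule emeasure_Diff) (use m in \<open>auto simp: emeasure_cball\<close>)
    also have "\<dots> = ennreal (?V * R ^ ?n - ?V * ?m ^ ?n)"
      using m assms V by (simp add: emeasure_cball ennreal_minus)
    finally show ?thesis using False by simp
  qed
  finally have M: "emeasure ?M {x<..} = ennreal (?V * R ^ ?n - ?V * ?m ^ ?n)" .
  show "emeasure ?M {x<..} < \<infinity>" by (simp add: M)
  have "emeasure ?N {x<..} = (\<integral>\<^sup>+r. ennreal (real ?n * ?V * r ^ (?n - 1)) * indicator {0..R} r * indicator {x<..} r \<partial>lborel)"
    by (rule emeasure_density) auto
  \<comment> \<open>The two integrands differ at most at the single point \<open>?m\<close>.\<close>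
  also have "\<dots> = (\<integral>\<^sup>+r. ennreal (real ?n * ?V * r ^ (?n - 1)) * indicator {?m..R} r \<partial>lborel)"
    by (rule nn_integral_cong_AE, rule AE_mp[OF AE_lborel_singleton[of ?m]])
      (auto intro!: AE_I2 simp: indicator_def min_def max_def)
  also have "\<dots> = ennreal (?V * R ^ ?n - ?V * ?m ^ ?n)"
  proof (rule nn_integral_FTC_Icc)
    fix r assume r: "r \<in> {?m..R}"
    show "((\<lambda>r. ?V * r ^ ?n) has_real_derivative real ?n * ?V * r ^ (?n - 1)) (at r)"
      by (auto intro!: derivative_eq_intros)
    show "0 \<le> real ?n * ?V * r ^ (?n - 1)"
      using m r V by (intro mult_nonneg_nonneg zero_le_power) auto
  qed (use m in auto)
  finally show "emeasure ?M {x<..} = emeasure ?N {x<..}" using M by simp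
qed auto

text \<open>After passing to the distribution of the norm, the weight cancels the factor
  \<open>r ^ (DIM('a) - 1)\<close> of the density and leaves a constant on the interval from 0 to
  \<open>R\<close>.\<close>

lemma has_bochner_integral_inverse_norm_power_cball:
  fixes R :: real
  assumes "0 < R"
  shows "has_bochner_integral lborel
    (\<lambda>x::'a::euclidean_space. indicator (cball 0 R) x / norm x ^ (DIM('a) - 1))
    (real DIM('a) * unit_ball_vol DIM('a) * R)"
proof (rule has_bochner_integral_nn_integral)
  let ?n = "DIM('a)" and ?V = "unit_ball_vol (real DIM('a))"
  have V: "0 \<le> ?V" by simp
  have [measurable]: "cball (0::'a) r \<in> sets borel" for r
    by (simp add: borel_closed)
  show "(\<lambda>x. indicator (cball (0::'a) R) x / norm x ^ (?n - 1)) \<in> borel_measurable lborel"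
    by measurable
  show "0 \<le> real ?n * ?V * R" using assms V by simp
  have "(\<integral>\<^sup>+x. ennreal (indicator (cball (0::'a) R) x / norm x ^ (?n - 1)) \<partial>lborel)
     = (\<integral>\<^sup>+x. indicator (cball (0::'a) R) x * ennreal (1 / norm x ^ (?n - 1)) \<partial>lborel)"
    by (intro nn_integral_cong) (auto simp: indicator_def)
  also have "\<dots> = (\<integral>\<^sup>+x. ennreal (1 / norm x ^ (?n - 1)) \<partial>density lborel (indicator (cball (0::'a) R)))"
    by (rule nn_integral_density[symmetric]) auto
  also have "\<dots> = (\<integral>\<^sup>+r. ennreal (1 / r ^ (?n - 1)) \<partial>distr (density lborel (indicator (cball (0::'a) R))) borel norm)"
    by (rule nn_integral_distr[symmetric]) auto
  also have "\<dots> = (\<integral>\<^sup>+r. ennreal (real ?n * ?V * r ^ (?n - 1)) * indicator {0..R} r * ennreal (1 / r ^ (?n - 1)) \<partial>lborel)"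
    unfolding distr_norm_cball[OF assms] by (rule nn_integral_density) auto
  \<comment> \<open>The cancellation may fail at \<open>r = 0\<close>, where division by zero yields
    0, so that point is discarded as a null set.\<close>
  also have "\<dots> = (\<integral>\<^sup>+r. ennreal (real ?n * ?V) * indicator {0..R} r \<partial>lborel)"
    by (rule nn_integral_cong_AE, rule AE_mp[OF AE_lborel_singleton[of 0]])
      (use V in \<open>auto intro!: AE_I2 simp: indicator_def simp flip: ennreal_mult\<close>)
  also have "\<dots> = ennreal (real ?n * ?V * R)"
    using assms V by (subst nn_integral_cmult) (auto simp flip: ennreal_mult)
  finally show "(\<integral>\<^sup>+x. ennreal (indicator (cball (0::'a) R) x / norm x ^ (?n - 1)) \<partial>lborel)
     = ennreal (real ?n * ?V * R)" .
qed auto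

text \<open>The functional equation of \<open>Gamma\<close> relates its values at
  \<open>n / 2\<close> and \<open>n / 2 + 1\<close>, which occur in the two formulas.\<close>

lemma sphere_area_eq_unit_ball_vol:
  assumes "0 < n"
  shows "sphere_area n = real n * unit_ball_vol n"
proof -
  have "Gamma (real n / 2 + 1) = real n / 2 * Gamma (real n / 2)"
    using assms by (intro Gamma_plus1) auto
  moreover have "Gamma (real n / 2) > 0" using assms by (intro Gamma_real_pos) auto
  ultimately show ?thesis using assms
    unfolding sphere_area_def unit_ball_vol_def by (simp only:) (simp add: field_simps)
qed

section \<open>The mean value formula for the weight given by the inverse power of the
  distance\<close>

theorem theorem3:
  fixes f :: "('n::{finite,linorder}) rvec \<Rightarrow> 'n clifford"
    and U :: "'n rvec set" and y :: "'n rvec" and R :: real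
  assumes "open U" and "connected U"
    and "left_clifford_holomorphic f U"
    and "R > 0" and "cball y R \<subseteq> U"
  shows "f y = (1 / (R * sphere_area CARD('n))) *\<^sub>R
           set_lebesgue_integral lebesgue (cball y R)
             (\<lambda>x. (1 / norm (x - y) ^ (CARD('n) - 1)) *\<^sub>R f x)"
proof -
  obtain f' where f'U: "\<And>x. x \<in> U \<Longrightarrow> (f has_derivative blinfun_apply (f' x)) (at x)" "continuous_on U f'"
    using assms(3) unfolding left_clifford_holomorphic_def C1_on_def by blast
  have f: "(f has_derivative blinfun_apply (f' x)) (at x)" if "x \<in> cball y R" for x
    using f'U(1) that assms(5) by blast
  have f': "continuous_on (cball y R) f'"
    using f'U(2) assms(5) by (rule continuous_on_subset)
  have hol: "(\<Sum>j\<in>UNIV. cl_gen j \<odot> blinfun_apply (f' x) (axis j 1)) = 0" if "x \<in> cball y R" for x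
    using assms(3,5) that unfolding left_clifford_holomorphic_def frechet_derivative_at[OF f[OF that]]
    by blast
  have fc: "continuous_on (cball y R) f"
    using f by (meson continuous_at_imp_continuous_on has_derivative_continuous)
  \<comment> \<open>The indicator of the ball is built into the weight, so the set integral becomes
    an integral over the whole space. The total mass of \<open>w\<close> is exactly the normalizing
    constant of the formula.\<close>
  define w where "w x = indicator (cball 0 R) x / norm x ^ (CARD('n) - 1)" for x :: "'n rvec"
  have w: "has_bochner_integral lborel w (R * sphere_area CARD('n))"
    using has_bochner_integral_inverse_norm_power_cball[OF assms(4), where 'a = "'n rvec"]
    by (simp add: w_def[abs_def] sphere_area_eq_unit_ball_vol mult_ac)
  have area: "R * sphere_area CARD('n) \<noteq> 0"
    using assms(4) unit_ball_vol_pos[of "real CARD('n)"] by (simp add: sphere_area_eq_unit_ball_vol del: unit_ball_vol_pos)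
  let ?g = "\<lambda>x. indicator (cball y R) x *\<^sub>R ((1 / norm (x - y) ^ (CARD('n) - 1)) *\<^sub>R f x)"
  have "(\<lambda>x. indicator (cball y R) x *\<^sub>R f x) \<in> borel_measurable borel"
    by (rule borel_measurable_continuous_on_indicator[OF _ fc]) (simp add: borel_closed)
  then have "(\<lambda>x. (1 / norm (x - y) ^ (CARD('n) - 1)) *\<^sub>R (indicator (cball y R) x *\<^sub>R f x)) \<in> borel_measurable borel"
    by (rule borel_measurable_scaleR[rotated]) measurable
  then have g: "?g \<in> borel_measurable borel"
    by (simp only: scaleR_left_commute)
  \<comment> \<open>The integrand is Borel measurable, so its integral against the completed measure
    equals that against \<open>lborel\<close>; a translation then moves the centre \<open>y\<close>
    to the origin.\<close>
  have "set_lebesgue_integral lebesgue (cball y R) (\<lambda>x. (1 / norm (x - y) ^ (CARD('n) - 1)) *\<^sub>R f x)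
      = (\<integral>x. ?g x \<partial>lborel)"
    unfolding set_lebesgue_integral_def using g by (intro integral_completion) simp
  also have "\<dots> = (\<integral>x. ?g x \<partial>distr lborel borel ((+) y))"
    by (simp only: lborel_distr_plus)
  also have "\<dots> = (\<integral>x. ?g (y + x) \<partial>lborel)"
    using g by (intro integral_distr) auto
  also have "\<dots> = (\<integral>x. w x *\<^sub>R f (y + x) \<partial>lborel)"
    by (intro Bochner_Integration.integral_cong) (auto simp: w_def indicator_def dist_norm)
  also have "\<dots> = (\<integral>x. w x \<partial>lborel) *\<^sub>R f y"
  proof (rule clifford_holomorphic_radial_weight_mean_value[where f' = f' and R = R])
    show "integrable lborel w" using w by (rule integrable.intros)
    show "w x = 0" if "x \<notin> cball 0 R" for x
      using that by (simp add: w_def)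
    show "w (T x) = w x" if "orthogonal_transformation T" for T x
      using that by (simp add: w_def indicator_def orthogonal_transformation_norm)
  qed (use f f' hol in auto)
  also have "(\<integral>x. w x \<partial>lborel) = R * sphere_area CARD('n)"
    using w by (rule has_bochner_integral_integral_eq)
  finally show ?thesis using area by simp
qed

end
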